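(* There is an absolute constant $C\ge 1$ such that the following holds. Let $W\subset\mathbb R^n$ be a linear subspace of dimension $d\ge 1$. For $\beta>0$ and an integer $s\ge 1$, let \[ \mathcal F_W(\beta,s):=\left\{I\subset\{1,\dots,n\}:\ |I|=s,\ \exists x\in W,\ \|x\|_2\le 1,\ |x_i|\ge\beta\ \text{for every } i\in I\right\}. \] Then \[ |\mathcal F_W(\beta,s)|\le \frac{\beta^{-2s}}{s!}\binom{d+s-1}{s}\le\left(C\,\frac{d+s}{\beta^2s^2}\right)^s . \]
   Context: $\|\cdot\|_2$ is the Euclidean norm and $|I|$ denotes cardinality. *)

theory Defs
  imports "HOL-Analysis.Analysis" "HOL-Analysis.Finite_Function_Topology"
begin

text \<open>
  The dimension \<open>n\<close> is quantified inside the theorem, underneath the absolute constant, so it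
  cannot be a type index as in \<open>real ^ 'n\<close>. Instead, \<open>Rn n\<close> is realised inside the real vector
  space of finitely supported functions on the naturals, as the vectors whose coordinates outside
  \<open>{1..n}\<close> vanish; \<open>subspace\<close> and \<open>dim\<close> are then those of the library. The coordinate \<open>x\<^sub>i\<close> is
  \<open>Poly_Mapping.lookup x i\<close>.
\<close>

definition Rn :: "nat \<Rightarrow> (nat \<Rightarrow>\<^sub>0 real) set"
  where "Rn n = {x. Poly_Mapping.keys x \<subseteq> {1..n}}"

text \<open>
  The class operation \<open>norm\<close> on \<open>nat \<Rightarrow>\<^sub>0 real\<close> is the \<open>\<ell>\<^sup>1\<close>-norm, so the Euclidean norm on
  \<open>Rn n\<close> is written with \<open>L2_set\<close>.
\<close>

definition norm2 :: "nat \<Rightarrow> (nat \<Rightarrow>\<^sub>0 real) \<Rightarrow> real"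
  where "norm2 n x = L2_set (Poly_Mapping.lookup x) {1..n}"

definition large_coord_sets :: "nat \<Rightarrow> (nat \<Rightarrow>\<^sub>0 real) set \<Rightarrow> real \<Rightarrow> nat \<Rightarrow> nat set set"
  where "large_coord_sets n W \<beta> s =
    {I. I \<subseteq> {1..n} \<and> card I = s \<and>
        (\<exists>x\<in>W. norm2 n x \<le> 1 \<and> (\<forall>i\<in>I. \<bar>Poly_Mapping.lookup x i\<bar> \<ge> \<beta>))}"

lemma lookup_scaleR_poly_mapping:
  fixes x :: "'a \<Rightarrow>\<^sub>0 'b::real_vector"
  shows "Poly_Mapping.lookup (c *\<^sub>R x) i = c *\<^sub>R Poly_Mapping.lookup x i"
proof -
  have "{i. c *\<^sub>R Poly_Mapping.lookup x i \<noteq> 0} \<subseteq> Poly_Mapping.keys x"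
    by (auto simp: in_keys_iff)
  then have "finite {i. c *\<^sub>R Poly_Mapping.lookup x i \<noteq> 0}"
    using finite_keys finite_subset by blast
  then show ?thesis
    unfolding scaleR_poly_mapping_def by (simp add: Abs_poly_mapping_inverse)
qed

lemma Rn_iff: "x \<in> Rn n \<longleftrightarrow> (\<forall>i. i \<notin> {1..n} \<longrightarrow> Poly_Mapping.lookup x i = 0)"
  unfolding Rn_def by (auto simp: in_keys_iff)

lemma subspace_Rn: "subspace (Rn n)"
  unfolding subspace_def by (auto simp: Rn_iff lookup_add lookup_scaleR_poly_mapping)

lemma dim_Rn: "dim (Rn n) = n"
proof -
  let ?e = "\<lambda>i::nat. Poly_Mapping.single i (1::real)"
  have inj: "inj_on ?e {1..n}"
    by (rule inj_onI) (metis lookup_single_eq lookup_single_not_eq zero_neq_one)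
  have lk: "Poly_Mapping.lookup (\<Sum>i\<in>{1..n}. c i *\<^sub>R ?e i) j = (if j \<in> {1..n} then c j else 0)"
    for c j
    by (simp add: lookup_sum lookup_scaleR_poly_mapping lookup_single when_def if_distrib sum.delta cong: if_cong)
  have "independent (?e ` {1..n})"
  proof (rule independent_if_scalars_zero)
    fix u v assume u: "(\<Sum>v\<in>?e ` {1..n}. u v *\<^sub>R v) = 0" and v: "v \<in> ?e ` {1..n}"
    from v obtain j where j: "j \<in> {1..n}" "v = ?e j" by blast
    from u have "(\<Sum>i\<in>{1..n}. u (?e i) *\<^sub>R ?e i) = 0"
      by (simp only: sum.reindex[OF inj] o_def)
    then show "u v = 0" using lk[of "\<lambda>i. u (?e i)" j] j by simp
  qed simp
  moreover have "Rn n \<subseteq> span (?e ` {1..n})"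
  proof
    fix x assume "x \<in> Rn n"
    then have "x = (\<Sum>i\<in>{1..n}. Poly_Mapping.lookup x i *\<^sub>R ?e i)"
      by (intro poly_mapping_eqI) (simp only: lk, auto simp: Rn_iff)
    also have "\<dots> \<in> span (?e ` {1..n})"
      by (intro span_sum span_scale span_base) auto
    finally show "x \<in> span (?e ` {1..n})" .
  qed
  moreover have "?e ` {1..n} \<subseteq> Rn n" by (auto simp: Rn_def)
  ultimately have "card (?e ` {1..n}) = dim (Rn n)"
    by (intro basis_card_eq_dim)
  moreover have "card (?e ` {1..n}) = n" using card_image[OF inj] by simp
  ultimately show ?thesis by (simp only:)
qed

end

theory Submission
  imports Defs
begin

text \<open>
  Take an orthonormal basis \<open>B\<close> of \<open>W\<close> and write \<open>x = (\<Sum>b\<in>B. c b *\<^sub>R b)\<close>. For a tuple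
  \<open>t\<close> of \<open>s\<close> coordinate indices, \<open>\<Prod>k<s. x (t k)\<close> is a homogeneous polynomial of degree \<open>s\<close>
  in the coefficients \<open>c\<close>, hence the pairing of the symmetric power of \<open>x\<close>, a vector of norm
  \<open>\<parallel>x\<parallel>\<^sup>s\<close>, with a vector \<open>v t\<close> of the symmetric power of \<open>W\<close> that depends on \<open>t\<close> alone. That
  space has dimension \<open>(d + s - 1) choose s\<close>, one basis vector for each multiset of \<open>s\<close> elements
  of \<open>B\<close>. The vectors \<open>v t\<close>, over all tuples \<open>t\<close>, are the projections onto it of an
  orthonormal basis of the \<open>s\<close>-fold tensor power of the ambient space, so \<open>\<Sum>t. \<parallel>v t\<parallel>\<^sup>2\<close> is the trace of the projection,
  which is this dimension.

  If \<open>t\<close> enumerates a member \<open>I\<close> of the family, a witness \<open>x\<close> for \<open>I\<close> gives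
  \<open>\<beta>\<^sup>s \<le> \<bar>\<Prod>k<s. x (t k)\<bar> \<le> \<parallel>v t\<parallel>\<close>. Every \<open>I\<close> has \<open>s!\<close> enumerations, and different sets share
  none, so \<open>card F * s! * \<beta> ^ (2 * s) \<le> (d + s - 1) choose s\<close> for the family \<open>F\<close>; this is the first
  inequality. The witness may change from one \<open>I\<close> to the next precisely because \<open>v t\<close> does not
  involve it.

  No tensor products are constructed: \<open>v t\<close> is represented by the coordinates \<open>sym_coeff\<close>, and the
  argument rests on the Cauchy--Schwarz bound \<open>prod_coords_le\<close> and the trace identity
  \<open>sum_sym_coeff_sq\<close>, which \<open>card_large_product_sets_le\<close> combines. The second inequality is
  \<open>(m choose s) * s! \<le> m ^ s\<close> together with \<open>s ^ s \<le> exp s * s!\<close>, used twice; this makes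
  \<open>C = exp 2\<close> suffice.
\<close>

section \<open>Orthonormal spanning sets for a bilinear form\<close>

text \<open>
  Gram--Schmidt: each new vector is reduced by its projection onto the span so far and either
  vanishes or is normalised and added. The form is a parameter because the norm of the type
  \<open>nat \<Rightarrow>\<^sub>0 real\<close> is not Euclidean, so the inner product has to be supplied by hand; it is
  only semidefinite on the whole type and becomes definite on the vectors supported in \<open>{1..n}\<close>.
\<close>

lemma orthonormal_spanning_set:
  fixes ip :: "'a::real_vector \<Rightarrow> 'a \<Rightarrow> real"
  assumes bil: "bilinear ip" and sym: "\<And>x y. ip x y = ip y x"
    and fin: "finite A" and pos: "\<And>x. x \<in> span A \<Longrightarrow> x \<noteq> 0 \<Longrightarrow> ip x x > 0"
  shows "\<exists>B. finite B \<and> card B \<le> card A \<and> span B = span A \<and>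
    (\<forall>a\<in>B. \<forall>b\<in>B. ip a b = (if a = b then 1 else 0))"
  using fin pos
proof (induction A rule: finite_induct)
  case empty
  then show ?case by (intro exI[of _ "{}"]) simp
next
  case (insert a A)
  have "span A \<subseteq> span (insert a A)" by (intro span_mono) auto
  with insert obtain B where B: "finite B" "card B \<le> card A" "span B = span A"
    and on: "\<And>a b. a \<in> B \<Longrightarrow> b \<in> B \<Longrightarrow> ip a b = (if a = b then 1 else 0)"
    by (metis subsetD)
  have span_a: "span (insert a A) = span (insert a B)"
    using B(3) by (simp add: span_insert)
  define p where "p = (\<Sum>b\<in>B. ip a b *\<^sub>R b)"
  define r where "r = a - p"
  have p: "p \<in> span B" unfolding p_def by (intro span_sum span_scale span_base)
  have orth: "ip r b = 0" if "b \<in> B" for b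
  proof -
    have lin: "linear (\<lambda>x. ip x b)" using bil by (simp add: bilinear_def)
    have "ip p b = (\<Sum>c\<in>B. ip a c * ip c b)"
      unfolding p_def linear_sum[OF lin] by (simp add: bilinear_lmul[OF bil])
    also have "\<dots> = (\<Sum>c\<in>B. if c = b then ip a b else 0)"
      by (intro sum.cong) (auto simp: on that)
    also have "\<dots> = ip a b" using that B(1) by simp
    finally show ?thesis by (simp add: r_def bilinear_lsub[OF bil])
  qed
  show ?case
  proof (cases "r = 0")
    case True
    then have "a \<in> span B" using p by (simp add: r_def)
    then have "span B = span (insert a A)" by (simp add: span_a span_redundant)
    moreover have "card B \<le> card (insert a A)" using B(2) insert by simp
    ultimately show ?thesis using B(1) on by blast
  next
    case False
    have "r \<in> span (insert a B)"
      unfolding r_def using p span_mono[of B "insert a B"]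
      by (intro span_diff) (auto intro: span_base)
    then have pos_r: "ip r r > 0" using False insert.prems span_a by simp
    define q where "q = (1 / sqrt (ip r r)) *\<^sub>R r"
    have qq: "ip q q = 1"
      using pos_r by (simp add: q_def bilinear_lmul[OF bil] bilinear_rmul[OF bil])
    have qb: "ip q b = 0" "ip b q = 0" if "b \<in> B" for b
      using orth[OF that] sym[of b q] by (simp_all add: q_def bilinear_lmul[OF bil])
    have a_eq: "a = sqrt (ip r r) *\<^sub>R q + p"
      using pos_r by (simp add: q_def r_def)
    have "span (insert q B) = span (insert a B)"
    proof (subst span_eq, intro conjI subsetI)
      fix x assume "x \<in> insert q B"
      then show "x \<in> span (insert a B)"
        using \<open>r \<in> span (insert a B)\<close> by (auto simp: q_def intro: span_scale span_base)
    next
      fix x assume x: "x \<in> insert a B"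
      have "p \<in> span (insert q B)" using p span_mono[of B "insert q B"] by auto
      then have "sqrt (ip r r) *\<^sub>R q + p \<in> span (insert q B)"
        by (rule span_add[rotated]) (simp add: span_scale span_base)
      then have "a \<in> span (insert q B)" using a_eq by simp
      then show "x \<in> span (insert q B)" using x by (auto intro: span_base)
    qed
    moreover have "card (insert q B) \<le> card (insert a A)"
      using B(1,2) insert by (simp add: card_insert_if)
    moreover have "ip x y = (if x = y then 1 else 0)" if "x \<in> insert q B" "y \<in> insert q B" for x y
      using that on qq qb by fastforce
    ultimately show ?thesis
      using B(1) span_a by (intro exI[of _ "insert q B"]) auto
  qed
qed

section \<open>Products of coordinates as vectors indexed by multisets\<close>

text \<open>
  Expanding a product of \<open>s\<close> sums over \<open>B\<close> gives one term for each choice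
  \<open>f \<in> {..<s} \<rightarrow>\<^sub>E B\<close> of summands. Its monomial in the coefficients depends only on the multiset
  of chosen elements.
\<close>

definition profile :: "nat \<Rightarrow> (nat \<Rightarrow> 'b) \<Rightarrow> 'b multiset"
  where "profile s f = image_mset f (mset_set {..<s})"

definition selections :: "'b set \<Rightarrow> nat \<Rightarrow> 'b multiset \<Rightarrow> (nat \<Rightarrow> 'b) set"
  where "selections B s m = {f \<in> {..<s} \<rightarrow>\<^sub>E B. profile s f = m}"

text \<open>
  The coefficient of the monomial indexed by \<open>m\<close> in \<open>\<Prod>k<s. \<Sum>b\<in>B. c b * U b (t k)\<close>, seen as a
  polynomial in the unknowns \<open>c\<close>. It is the permanent of the \<open>s\<close> by \<open>s\<close> matrix of
  values of \<open>U\<close> at the elements of \<open>m\<close> and the entries of \<open>t\<close>, divided by the factorials of the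
  multiplicities in \<open>m\<close>.
\<close>

definition sym_coeff :: "('b \<Rightarrow> 'j \<Rightarrow> real) \<Rightarrow> 'b set \<Rightarrow> nat \<Rightarrow> 'b multiset \<Rightarrow> (nat \<Rightarrow> 'j) \<Rightarrow> real"
  where "sym_coeff U B s m t = (\<Sum>f\<in>selections B s m. \<Prod>k<s. U (f k) (t k))"

lemma finite_selections: "finite B \<Longrightarrow> finite (selections B s m)"
  unfolding selections_def by (rule finite_subset[of _ "{..<s} \<rightarrow>\<^sub>E B"]) (blast, simp add: finite_PiE)

lemma sum_over_profiles:
  assumes "finite B"
  shows "(\<Sum>m\<in>profile s ` ({..<s} \<rightarrow>\<^sub>E B). \<Sum>f\<in>selections B s m. g f) = (\<Sum>f\<in>{..<s} \<rightarrow>\<^sub>E B. g f)"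
  unfolding selections_def using assms by (intro sum.group) (simp_all add: finite_PiE)

lemma card_profiles_le:
  assumes "finite B"
  shows "card (profile s ` ({..<s} \<rightarrow>\<^sub>E B)) \<le> (card B + s - 1) choose s"
proof -
  have "profile s ` ({..<s} \<rightarrow>\<^sub>E B) \<subseteq> multisets_of_size B s"
  proof (intro image_subsetI)
    fix f assume "f \<in> {..<s} \<rightarrow>\<^sub>E B"
    then have "f ` {..<s} \<subseteq> B" by blast
    then show "profile s f \<in> multisets_of_size B s"
      by (simp add: profile_def multisets_of_size_def)
  qed
  then have "card (profile s ` ({..<s} \<rightarrow>\<^sub>E B)) \<le> card (multisets_of_size B s)"
    by (rule card_mono[OF finite_multisets_of_size[OF assms]])
  then show ?thesis by (simp only: card_multisets_of_size[OF assms])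
qed

text \<open>
  Cauchy--Schwarz over monomials, with the monomial \<open>m\<close> weighted by the number of selections that
  produce it. These weights are the multinomial coefficients, so the factor containing \<open>c\<close> is the
  multinomial expansion of \<open>(\<Sum>b\<in>B. (c b)\<^sup>2) ^ s\<close>. The remaining factor is the squared norm of
  \<open>v t\<close>, which is free of \<open>c\<close>.
\<close>

lemma prod_coords_le:
  fixes U :: "'b \<Rightarrow> 'j \<Rightarrow> real"
  assumes B: "finite B" and c: "(\<Sum>b\<in>B. (c b)\<^sup>2) \<le> 1"
  shows "(\<Prod>k<s. \<Sum>b\<in>B. c b * U b (t k))\<^sup>2
    \<le> (\<Sum>m\<in>profile s ` ({..<s} \<rightarrow>\<^sub>E B). (sym_coeff U B s m t)\<^sup>2 / real (card (selections B s m)))"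
proof -
  let ?T = "profile s ` ({..<s} \<rightarrow>\<^sub>E B)"
  define N where "N m = real (card (selections B s m))" for m
  define C where "C m = prod_mset (image_mset c m)" for m
  have C: "(\<Prod>k<s. c (f k)) = C m" if "f \<in> selections B s m" for f m
  proof -
    have "m = image_mset f (mset_set {..<s})"
      using that by (simp add: selections_def profile_def)
    then have "C m = prod_mset (image_mset (\<lambda>k. c (f k)) (mset_set {..<s}))"
      by (simp only: C_def multiset.map_comp o_def)
    then show ?thesis by (simp only: prod_unfold_prod_mset)
  qed
  have N: "N m > 0" if "m \<in> ?T" for m
  proof -
    from that obtain f where "f \<in> selections B s m" by (auto simp: selections_def)
    then show ?thesis
      using finite_selections[OF B, of s m] by (auto simp: N_def card_gt_0_iff)
  qed
  have "(\<Prod>k<s. \<Sum>b\<in>B. c b * U b (t k)) = (\<Sum>f\<in>{..<s} \<rightarrow>\<^sub>E B. \<Prod>k<s. c (f k) * U (f k) (t k))"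
    using B by (intro prod_sum_PiE) auto
  also have "\<dots> = (\<Sum>m\<in>?T. \<Sum>f\<in>selections B s m. \<Prod>k<s. c (f k) * U (f k) (t k))"
    by (rule sum_over_profiles[OF B, symmetric])
  also have "\<dots> = (\<Sum>m\<in>?T. (sqrt (N m) * C m) * (sym_coeff U B s m t / sqrt (N m)))"
  proof (intro sum.cong refl)
    fix m assume m: "m \<in> ?T"
    have "(\<Sum>f\<in>selections B s m. \<Prod>k<s. c (f k) * U (f k) (t k)) = C m * sym_coeff U B s m t"
      unfolding sym_coeff_def sum_distrib_left by (intro sum.cong refl) (simp add: prod.distrib C)
    also have "\<dots> = (sqrt (N m) * C m) * (sym_coeff U B s m t / sqrt (N m))"
      using N[OF m] by simp
    finally show "(\<Sum>f\<in>selections B s m. \<Prod>k<s. c (f k) * U (f k) (t k)) = \<dots>" .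
  qed
  finally have "(\<Prod>k<s. \<Sum>b\<in>B. c b * U b (t k))\<^sup>2
      \<le> (\<Sum>m\<in>?T. (sqrt (N m) * C m)\<^sup>2) * (\<Sum>m\<in>?T. (sym_coeff U B s m t / sqrt (N m))\<^sup>2)"
    by (simp only: Cauchy_Schwarz_ineq_sum)
  also have "\<dots> \<le> 1 * (\<Sum>m\<in>?T. (sym_coeff U B s m t / sqrt (N m))\<^sup>2)"
  proof (intro mult_right_mono sum_nonneg)
    have "(\<Sum>m\<in>?T. (sqrt (N m) * C m)\<^sup>2) = (\<Sum>m\<in>?T. \<Sum>f\<in>selections B s m. \<Prod>k<s. (c (f k))\<^sup>2)"
    proof (intro sum.cong refl)
      fix m
      have "(\<Sum>f\<in>selections B s m. \<Prod>k<s. (c (f k))\<^sup>2) = (\<Sum>f\<in>selections B s m. (C m)\<^sup>2)"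
        by (intro sum.cong refl) (simp add: C flip: prod_power_distrib)
      then show "(sqrt (N m) * C m)\<^sup>2 = (\<Sum>f\<in>selections B s m. \<Prod>k<s. (c (f k))\<^sup>2)"
        by (simp add: power_mult_distrib N_def)
    qed
    also have "\<dots> = (\<Sum>f\<in>{..<s} \<rightarrow>\<^sub>E B. \<Prod>k<s. (c (f k))\<^sup>2)"
      by (rule sum_over_profiles[OF B])
    also have "\<dots> = (\<Prod>k<s. \<Sum>b\<in>B. (c b)\<^sup>2)"
      using B by (intro prod_sum_PiE[symmetric]) auto
    also have "\<dots> \<le> 1"
      using c by (simp add: power_le_one sum_nonneg)
    finally show "(\<Sum>m\<in>?T. (sqrt (N m) * C m)\<^sup>2) \<le> 1" .
  qed auto
  also have "\<dots> = (\<Sum>m\<in>?T. (sym_coeff U B s m t)\<^sup>2 / N m)"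
    by (simp add: power_divide N_def)
  finally show ?thesis by (simp add: N_def)
qed

text \<open>
  Squaring gives pairs \<open>(f, g)\<close> of selections, and summation over \<open>t\<close> factors position by position
  into inner products of the orthonormal rows \<open>U (f k)\<close> and \<open>U (g k)\<close>; only the diagonal
  \<open>f = g\<close> survives. Dividing by the weight used in Cauchy--Schwarz, each multiset contributes
  exactly \<open>1\<close> to the trace.
\<close>

lemma sum_sym_coeff_sq:
  fixes U :: "'b \<Rightarrow> 'j \<Rightarrow> real"
  assumes B: "finite B" and J: "finite J"
    and on: "\<And>a b. a \<in> B \<Longrightarrow> b \<in> B \<Longrightarrow> (\<Sum>i\<in>J. U a i * U b i) = (if a = b then 1 else 0)"
  shows "(\<Sum>t\<in>{..<s} \<rightarrow>\<^sub>E J. (sym_coeff U B s m t)\<^sup>2) = real (card (selections B s m))"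
proof -
  let ?S = "selections B s m"
  have "(\<Sum>t\<in>{..<s} \<rightarrow>\<^sub>E J. (sym_coeff U B s m t)\<^sup>2)
      = (\<Sum>t\<in>{..<s} \<rightarrow>\<^sub>E J. \<Sum>f\<in>?S. \<Sum>g\<in>?S. \<Prod>k<s. U (f k) (t k) * U (g k) (t k))"
    by (simp add: sym_coeff_def power2_eq_square sum_product prod.distrib)
  also have "\<dots> = (\<Sum>f\<in>?S. \<Sum>t\<in>{..<s} \<rightarrow>\<^sub>E J. \<Sum>g\<in>?S. \<Prod>k<s. U (f k) (t k) * U (g k) (t k))"
    by (rule sum.swap)
  also have "\<dots> = (\<Sum>f\<in>?S. \<Sum>g\<in>?S. \<Sum>t\<in>{..<s} \<rightarrow>\<^sub>E J. \<Prod>k<s. U (f k) (t k) * U (g k) (t k))"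
    by (intro sum.cong refl) (rule sum.swap)
  also have "\<dots> = (\<Sum>f\<in>?S. \<Sum>g\<in>?S. \<Prod>k<s. \<Sum>i\<in>J. U (f k) i * U (g k) i)"
    using J by (intro sum.cong refl prod_sum_PiE[symmetric]) auto
  also have "\<dots> = (\<Sum>f\<in>?S. \<Sum>g\<in>?S. if f = g then 1 else 0)"
  proof (intro sum.cong refl)
    fix f g assume "f \<in> ?S" "g \<in> ?S"
    then have fg: "f \<in> {..<s} \<rightarrow>\<^sub>E B" "g \<in> {..<s} \<rightarrow>\<^sub>E B" by (auto simp: selections_def)
    have "(\<Prod>k<s. \<Sum>i\<in>J. U (f k) i * U (g k) i) = (\<Prod>k<s. if f k = g k then 1 else 0)"
      using fg by (intro prod.cong refl on) auto
    also have "\<dots> = (if f = g then 1 else 0)"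
    proof (cases "f = g")
      case False
      then obtain k where "k < s" "f k \<noteq> g k" using fg by (meson PiE_ext lessThan_iff)
      then show ?thesis using False by (auto intro!: prod_zero)
    qed simp
    finally show "(\<Prod>k<s. \<Sum>i\<in>J. U (f k) i * U (g k) i) = (if f = g then 1 else 0)" .
  qed
  also have "\<dots> = real (card ?S)"
    using finite_selections[OF B] by simp
  finally show ?thesis .
qed

section \<open>Counting index sets\<close>

lemma card_enumerations:
  assumes "finite I" "card I = s"
  shows "card {t \<in> {..<s} \<rightarrow>\<^sub>E I. bij_betw t {..<s} I} = fact s"
proof -
  have "{t \<in> {..<s} \<rightarrow>\<^sub>E I. bij_betw t {..<s} I} = {t \<in> {..<s} \<rightarrow>\<^sub>E I. inj_on t {..<s}}"
  proof (intro Collect_cong conj_cong refl iffI)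
    fix t assume t: "t \<in> {..<s} \<rightarrow>\<^sub>E I" "inj_on t {..<s}"
    have "t ` {..<s} = I"
      using t assms by (intro card_subset_eq) (auto simp: card_image)
    then show "bij_betw t {..<s} I" using t(2) by (simp add: bij_betw_def)
  qed (simp add: bij_betw_def)
  also have "card \<dots> = fact s"
    using card_inj_on_subset_funcset[of "{..<s}" I "{..<s}"] assms
    by (simp add: fact_prod_rev)
  finally show ?thesis .
qed

text \<open>
  Double counting of \<open>\<Sum>t. w t\<close>, where \<open>w t\<close> is the squared norm of \<open>v t\<close>: from below, the tuples
  enumerating members of \<open>F\<close> contribute at least \<open>\<beta> ^ (2 * s)\<close> each; from above, interchanging the
  sums and using the trace identity leaves the number of multisets.
\<close>

lemma card_large_product_sets_le:
  fixes U :: "'b \<Rightarrow> 'j \<Rightarrow> real"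
  assumes B: "finite B" and J: "finite J"
    and on: "\<And>a b. a \<in> B \<Longrightarrow> b \<in> B \<Longrightarrow> (\<Sum>i\<in>J. U a i * U b i) = (if a = b then 1 else 0)"
    and \<beta>: "\<beta> \<ge> 0"
    and F: "\<And>I. I \<in> F \<Longrightarrow> I \<subseteq> J \<and> card I = s \<and>
      (\<exists>c. (\<Sum>b\<in>B. (c b)\<^sup>2) \<le> 1 \<and> (\<forall>i\<in>I. \<bar>\<Sum>b\<in>B. c b * U b i\<bar> \<ge> \<beta>))"
  shows "real (card F) * (fact s * \<beta> ^ (2 * s)) \<le> real ((card B + s - 1) choose s)"
proof -
  let ?T = "profile s ` ({..<s} \<rightarrow>\<^sub>E B)"
  let ?P = "{..<s} \<rightarrow>\<^sub>E J"
  define E where "E I = {t \<in> {..<s} \<rightarrow>\<^sub>E I. bij_betw t {..<s} I}" for I :: "'j set"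
  define w where "w t = (\<Sum>m\<in>?T. (sym_coeff U B s m t)\<^sup>2 / real (card (selections B s m)))" for t
  have finP: "finite ?P" using J by (intro finite_PiE) auto
  have "F \<subseteq> Pow J" using F by blast
  then have finF: "finite F" using J finite_subset by blast
  have finI: "finite I" if "I \<in> F" for I using F[OF that] J finite_subset by blast
  have finE: "finite (E I)" if "I \<in> F" for I
    unfolding E_def
    by (rule finite_subset[of _ "{..<s} \<rightarrow>\<^sub>E I"]) (blast, simp add: finite_PiE finI[OF that])
  have w_nonneg: "w t \<ge> 0" for t unfolding w_def by (intro sum_nonneg) auto
  have large: "\<beta> ^ (2 * s) \<le> w t" if I: "I \<in> F" and t: "t \<in> E I" for I t
  proof -
    obtain c where c: "(\<Sum>b\<in>B. (c b)\<^sup>2) \<le> 1" "\<And>i. i \<in> I \<Longrightarrow> \<bar>\<Sum>b\<in>B. c b * U b i\<bar> \<ge> \<beta>"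
      using F[OF I] by blast
    have "\<beta> ^ s = (\<Prod>k<s. \<beta>)" by simp
    also have "\<dots> \<le> (\<Prod>k<s. \<bar>\<Sum>b\<in>B. c b * U b (t k)\<bar>)"
      using t c(2) \<beta> by (intro prod_mono) (auto simp: E_def)
    also have "\<dots> = \<bar>\<Prod>k<s. \<Sum>b\<in>B. c b * U b (t k)\<bar>" by (simp add: abs_prod)
    finally have "(\<beta> ^ s)\<^sup>2 \<le> (\<Prod>k<s. \<Sum>b\<in>B. c b * U b (t k))\<^sup>2"
      using \<beta> by (metis power2_abs power_mono zero_le_power)
    also have "\<dots> \<le> w t" unfolding w_def by (rule prod_coords_le[OF B c(1)])
    finally show ?thesis by (simp add: power_mult[symmetric] mult.commute)
  qed
  have "real (card F) * (fact s * \<beta> ^ (2 * s)) = (\<Sum>I\<in>F. \<Sum>t\<in>E I. \<beta> ^ (2 * s))"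
    using F finI by (simp add: E_def card_enumerations)
  also have "\<dots> \<le> (\<Sum>I\<in>F. \<Sum>t\<in>E I. w t)"
    by (intro sum_mono large)
  also have "\<dots> = (\<Sum>t\<in>\<Union>(E ` F). w t)"
    using finF finE by (intro sum.UNION_disjoint[symmetric]) (auto simp: E_def bij_betw_def)
  also have "\<dots> \<le> (\<Sum>t\<in>?P. w t)"
  proof (intro sum_mono2 finP w_nonneg UN_least)
    fix I assume "I \<in> F"
    then have "{..<s} \<rightarrow>\<^sub>E I \<subseteq> ?P" using F by (intro PiE_mono) blast
    then show "E I \<subseteq> ?P" unfolding E_def by blast
  qed
  also have "\<dots> = (\<Sum>m\<in>?T. \<Sum>t\<in>?P. (sym_coeff U B s m t)\<^sup>2 / real (card (selections B s m)))"
    unfolding w_def by (rule sum.swap)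
  also have "\<dots> = (\<Sum>m\<in>?T. real (card (selections B s m)) / real (card (selections B s m)))"
    by (simp only: sum_divide_distrib[symmetric] sum_sym_coeff_sq[OF B J on])
  also have "\<dots> \<le> (\<Sum>m\<in>?T. 1)"
    by (intro sum_mono) (simp add: divide_le_eq_1)
  also have "\<dots> \<le> real ((card B + s - 1) choose s)"
    using card_profiles_le[OF B, of s] by simp
  finally show ?thesis .
qed

lemma choose_mono_upper: "m \<le> n \<Longrightarrow> m choose k \<le> n choose k"
  by (rule lift_Suc_mono_le[of "\<lambda>n. n choose k"]) (cases k; simp)

text \<open>
  In an orthonormal basis of \<open>W\<close> the Euclidean norm of a vector is the \<open>\<ell>\<^sup>2\<close>-norm of its
  coefficients, which turns the geometric family into one to which the double counting applies.
\<close>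

lemma card_large_coord_sets_le:
  assumes W: "W \<subseteq> Rn n" "subspace W" and d: "dim W \<ge> 1" and \<beta>: "\<beta> > 0"
  shows "real (card (large_coord_sets n W \<beta> s)) * (fact s * \<beta> ^ (2 * s))
    \<le> real ((dim W + s - 1) choose s)"
proof -
  define ip :: "(nat \<Rightarrow>\<^sub>0 real) \<Rightarrow> (nat \<Rightarrow>\<^sub>0 real) \<Rightarrow> real"
    where "ip x y = (\<Sum>i\<in>{1..n}. Poly_Mapping.lookup x i * Poly_Mapping.lookup y i)" for x y
  have bil: "bilinear ip"
    unfolding bilinear_def
    by (auto intro!: linearI simp: ip_def lookup_add lookup_scaleR_poly_mapping algebra_simps
        sum.distrib sum_distrib_left)
  have sym: "ip x y = ip y x" for x y by (simp add: ip_def mult.commute)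
  have norm2: "(norm2 n x)\<^sup>2 = ip x x" for x
    by (simp add: norm2_def L2_set_def ip_def power2_eq_square sum_nonneg)
  have pos: "ip x x > 0" if "x \<in> W" and nz: "x \<noteq> 0" for x
  proof -
    obtain i where i: "Poly_Mapping.lookup x i \<noteq> 0"
      using nz by (metis lookup_zero poly_mapping_eqI)
    then have "i \<in> {1..n}" using that W(1) Rn_iff by blast
    then show ?thesis unfolding ip_def using i by (intro sum_pos2[of _ i]) (auto simp: zero_less_mult_iff)
  qed
  obtain A where A: "A \<subseteq> W" "W \<subseteq> span A" "card A = dim W"
    using basis_exists[of W] by metis
  \<comment> \<open>An infinite basis would have cardinality, hence dimension, \<open>0\<close>, against \<open>d\<close>.\<close>
  have "finite A" using A(3) d by (intro card_ge_0_finite) simp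
  have spanA: "span A = W" using A W(2) by (simp add: span_minimal subset_antisym)
  obtain B where B: "finite B" "card B \<le> dim W" "span B = W"
    and on: "\<And>a b. a \<in> B \<Longrightarrow> b \<in> B \<Longrightarrow> ip a b = (if a = b then 1 else 0)"
    using orthonormal_spanning_set[OF bil sym \<open>finite A\<close>] pos spanA A(3) by metis
  have "real (card (large_coord_sets n W \<beta> s)) * (fact s * \<beta> ^ (2 * s))
      \<le> real ((card B + s - 1) choose s)"
  proof (rule card_large_product_sets_le[where J = "{1..n}" and U = Poly_Mapping.lookup])
    show "(\<Sum>i\<in>{1..n}. Poly_Mapping.lookup a i * Poly_Mapping.lookup b i) = (if a = b then 1 else 0)"
      if "a \<in> B" "b \<in> B" for a b using on[OF that] by (simp add: ip_def)
    fix I assume I: "I \<in> large_coord_sets n W \<beta> s"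
    then obtain x where x: "x \<in> W" "norm2 n x \<le> 1" "\<And>i. i \<in> I \<Longrightarrow> \<bar>Poly_Mapping.lookup x i\<bar> \<ge> \<beta>"
      by (auto simp: large_coord_sets_def)
    obtain c where c: "x = (\<Sum>b\<in>B. c b *\<^sub>R b)"
      using x(1) span_finite[OF B(1)] B(3) by auto
    have lookup: "Poly_Mapping.lookup x i = (\<Sum>b\<in>B. c b * Poly_Mapping.lookup b i)" for i
      by (simp add: c lookup_sum lookup_scaleR_poly_mapping)
    have "ip x x = (\<Sum>(a, b)\<in>B \<times> B. ip (c a *\<^sub>R a) (c b *\<^sub>R b))"
      unfolding c by (rule bilinear_sum[OF bil])
    also have "\<dots> = (\<Sum>a\<in>B. \<Sum>b\<in>B. if a = b then (c a)\<^sup>2 else 0)"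
      unfolding sum.cartesian_product[symmetric]
      by (intro sum.cong refl)
        (auto simp: bilinear_lmul[OF bil] bilinear_rmul[OF bil] on power2_eq_square)
    also have "\<dots> = (\<Sum>a\<in>B. (c a)\<^sup>2)" using B(1) by simp
    finally have "(\<Sum>b\<in>B. (c b)\<^sup>2) \<le> 1"
      using x(2) norm2[of x] by (metis L2_set_nonneg norm2_def power_le_one)
    then show "I \<subseteq> {1..n} \<and> card I = s \<and> (\<exists>c. (\<Sum>b\<in>B. (c b)\<^sup>2) \<le> 1 \<and>
        (\<forall>i\<in>I. \<beta> \<le> \<bar>\<Sum>b\<in>B. c b * Poly_Mapping.lookup b i\<bar>))"
      using I x(3) unfolding lookup large_coord_sets_def by blast
  qed (use B \<beta> in auto)
  also have "\<dots> \<le> real ((dim W + s - 1) choose s)"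
    using B(2) by (intro of_nat_mono choose_mono_upper diff_le_mono add_right_mono)
  finally show ?thesis .
qed

section \<open>The closed-form bound\<close>

text \<open>The left side divided by \<open>fact s\<close> is a single term of the exponential series at \<open>s\<close>.\<close>

lemma power_self_le_exp_fact: "real s ^ s \<le> exp (real s) * fact s"
proof -
  have "real s ^ s /\<^sub>R fact s = (\<Sum>k\<in>{s}. real s ^ k /\<^sub>R fact k)" by simp
  also have "\<dots> \<le> suminf (\<lambda>k. real s ^ k /\<^sub>R fact k)"
    using exp_converges[of "real s"] by (intro sum_le_suminf) (auto simp: sums_iff)
  also have "\<dots> = exp (real s)" using exp_converges[of "real s"] by (simp add: sums_iff)
  finally show ?thesis by (simp add: field_simps)
qed

lemma powi_minus_double:
  fixes \<beta> :: real
  shows "\<beta> > 0 \<Longrightarrow> \<beta> powi (- (2 * int s)) = 1 / \<beta> ^ (2 * s)"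
  by (simp add: power_int_minus power_int_mult field_simps flip: power_mult)

text \<open>
  One factor \<open>1 / fact s\<close> is explicit and the binomial coefficient supplies a second, so the lower
  bound on the factorial enters squared and produces both \<open>exp 2\<close> and the square of \<open>s\<close>.
\<close>

lemma binomial_over_fact_le:
  assumes s: "s \<ge> 1" and \<beta>: "\<beta> > 0"
  shows "\<beta> powi (- (2 * int s)) / fact s * real ((d + s - 1) choose s)
    \<le> (exp 2 * ((real d + real s) / (\<beta>\<^sup>2 * (real s)\<^sup>2))) ^ s"
proof -
  have powi: "\<beta> powi (- (2 * int s)) = 1 / (\<beta>\<^sup>2) ^ s"
    using powi_minus_double[OF \<beta>, of s] by (simp add: power_mult)
  have "real ((d + s - 1) choose s) * fact s \<le> real (d + s - 1) ^ s"
    using binomial_fact_pow[of "d + s - 1" s] by (metis of_nat_fact of_nat_le_iff of_nat_mult of_nat_power)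
  also have "\<dots> \<le> (real d + real s) ^ s" by (intro power_mono) auto
  finally have 1: "real ((d + s - 1) choose s) * fact s \<le> (real d + real s) ^ s" .
  have "(real s ^ s)\<^sup>2 \<le> (exp (real s) * fact s)\<^sup>2"
    by (intro power_mono power_self_le_exp_fact) auto
  also have "\<dots> = exp 2 ^ s * (fact s)\<^sup>2"
    by (simp add: power_mult_distrib mult.commute flip: exp_of_nat_mult exp_double)
  finally have 2: "((real s)\<^sup>2) ^ s \<le> exp 2 ^ s * (fact s)\<^sup>2"
    by (simp add: mult.commute flip: power_mult)
  have "(real ((d + s - 1) choose s) * fact s) * ((real s)\<^sup>2) ^ s
      \<le> (real d + real s) ^ s * (exp 2 ^ s * (fact s)\<^sup>2)"
    by (intro mult_mono 1 2) auto
  then have 3: "real ((d + s - 1) choose s) / fact s \<le> exp 2 ^ s * (real d + real s) ^ s / ((real s)\<^sup>2) ^ s"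
    using s by (simp add: field_simps power2_eq_square)
  have "\<beta> powi (- (2 * int s)) / fact s * real ((d + s - 1) choose s)
      = (real ((d + s - 1) choose s) / fact s) / (\<beta>\<^sup>2) ^ s" by (simp add: powi)
  also have "\<dots> \<le> (exp 2 ^ s * (real d + real s) ^ s / ((real s)\<^sup>2) ^ s) / (\<beta>\<^sup>2) ^ s"
    using \<beta> by (intro divide_right_mono 3) auto
  also have "\<dots> = (exp 2 * ((real d + real s) / (\<beta>\<^sup>2 * (real s)\<^sup>2))) ^ s"
    by (simp add: power_mult_distrib power_divide mult.commute)
  finally show ?thesis .
qed

theorem lemma3p1:
  shows "\<exists>C::real. C \<ge> 1 \<and>
    (\<forall>(n::nat) (d::nat) (W :: (nat \<Rightarrow>\<^sub>0 real) set) (\<beta>::real) (s::nat).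
       W \<subseteq> Rn n \<longrightarrow> subspace W \<longrightarrow> dim W = d \<longrightarrow> d \<ge> 1 \<longrightarrow> \<beta> > 0 \<longrightarrow> s \<ge> 1 \<longrightarrow>
       real (card (large_coord_sets n W \<beta> s))
         \<le> \<beta> powi (- (2 * int s)) / fact s * real ((d + s - 1) choose s) \<and>
       \<beta> powi (- (2 * int s)) / fact s * real ((d + s - 1) choose s)
         \<le> (C * ((real d + real s) / (\<beta>\<^sup>2 * (real s)\<^sup>2))) ^ s)"
proof (intro exI[of _ "exp 2"] conjI allI impI)
  show "(1::real) \<le> exp 2" by simp
next
  fix n d s :: nat and W :: "(nat \<Rightarrow>\<^sub>0 real) set" and \<beta> :: real
  assume W: "W \<subseteq> Rn n" "subspace W" and d: "dim W = d" "d \<ge> 1" and \<beta>: "\<beta> > 0" and s: "s \<ge> 1"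
  have "real (card (large_coord_sets n W \<beta> s)) * (fact s * \<beta> ^ (2 * s)) \<le> real ((d + s - 1) choose s)"
    using card_large_coord_sets_le[OF W _ \<beta>] d by simp
  then show "real (card (large_coord_sets n W \<beta> s))
      \<le> \<beta> powi (- (2 * int s)) / fact s * real ((d + s - 1) choose s)"
    unfolding powi_minus_double[OF \<beta>] using \<beta> by (simp add: field_simps)
  show "\<beta> powi (- (2 * int s)) / fact s * real ((d + s - 1) choose s)
      \<le> (exp 2 * ((real d + real s) / (\<beta>\<^sup>2 * (real s)\<^sup>2))) ^ s"
    by (rule binomial_over_fact_le[OF s \<beta>])
qed

end
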